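(* Let $\mathcal{R}$ be the feasible region of a PPICOD problem and let $\mathcal{R}_1$ be the set of code length--satisfaction pairs collected by the decoding-centric method (Method 1, defined in the context). Then $\mathcal{R}_1^*=\mathcal{R}^*$, i.e., $\mathcal{R}_1$ and $\mathcal{R}$ have the same Pareto boundary.
   Context: Preferential pliable index coding (PPICOD). A sender has $m\ge 1$ messages $X_{[1:m]}=(X_1,\dots,X_m)$, each taking values in a finite field $\mathbb{F}_q$ of size $q$, where $[a:b]=\{a,a+1,\dots,b\}$ and $X_S=(X_i:i\in S)$. There are $n\ge 1$ receivers; receiver $i\in[1:n]$ already knows $X_{H_i}$ for some $H_i\subsetneq[1:m]$. The problem is described by an $n\times m$ preference matrix $\boldsymbol{P}=[P_{i,j}]$ with entries in $\mathbb{R}\cup\{\infty\}$, where $P_{i,j}$ is the preference rank receiver $i$ gives to $X_j$ (lower is better); $P_{i,j}$ is finite if $j\in[1:m]\setminus H_i$ and $P_{i,j}=\infty$ if $j\in H_i$. A (linear) code of length $\ell$ consists of: an encoding function $\mathsf{E}:\mathbb{F}_q^m\to\mathbb{F}_q^\ell$ of the form $\mathsf{E}(X_{[1:m]})=\boldsymbol{A}\boldsymbol{X}$ with $\boldsymbol{A}\in\mathbb{F}_q^{\ell\times m}$ and $\boldsymbol{X}=[X_1\;\cdots\;X_m]^{\mathrm T}$; a decoding choice $D:[1:n]\to[1:m]$; and for each $i\in[1:n]$ a decoding function $\mathsf{G}_i:\mathbb{F}_q^\ell\times\mathbb{F}_q^{|H_i|}\to\mathbb{F}_q$; such that $D(i)\in[1:m]\setminus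 H_i$ and $\mathsf{G}_i(\mathsf{E}(X_{[1:m]}),X_{H_i})=X_{D(i)}$ for all $i\in[1:n]$ and all $X_{[1:m]}\in\mathbb{F}_q^m$. Only linear encoding functions are considered. The overall satisfaction metric of the code is $s=\sum_{i=1}^n P_{i,D(i)}$. A pair $(\ell,s)$ is achievable if there is a code with code length $\ell$ and overall satisfaction metric $s$. The feasible region $\mathcal{R}$ is the set of all achievable pairs $(\ell,s)$ over all linear codes. A point $(\ell_1,s_1)$ dominates $(\ell_2,s_2)$ if and only if $\ell_1\le\ell_2$ and $s_1\le s_2$ with at least one inequality strict. For a set $\mathcal{T}$ of achievable pairs, its Pareto boundary $\mathcal{T}^*$ is the set of all points of $\mathcal{T}$ not dominated by any point of $\mathcal{T}$. Method 1 (decoding centric). A possible decoding choice is a map $D:[1:n]\to[1:m]$ with $D(i)\in[1:m]\setminus H_i$ for all $i$; its satisfaction metric is $s(D)=\sum_{i=1}^n P_{i,D(i)}$. Fixing $D$ turns the problem into an index coding problem (receiver $i$ knows $X_{H_i}$ and must decode $X_{D(i)}$); let $\ell_{\min}(D)$ be the minimum length of a (linear, over $\mathbb{F}_q$) code with decoding choice $D$. The set collected by the method is $\mathcal{R}_1=\{(\ell_{\min}(D),s(D)) : D \text{ a possible decoding choice}\}$. *)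

theory Defs
  imports
    "HOL-Library.Extended_Real"
    "HOL-Library.FuncSet"
    "Jordan_Normal_Form.Matrix"
begin

text \<open>
  Messages are indexed by \<open>{..<m}\<close> and receivers by \<open>{..<n}\<close>, following the 0-based
  indexing of the matrix library. The finite field is a type \<open>'q\<close> of sort
  \<open>{field, finite}\<close>. Preference ranks live in \<open>ereal\<close>; since an entry is infinite only when
  it equals \<open>\<infinity>\<close>, the value \<open>-\<infinity>\<close> never occurs.
\<close>

definition ppicod_problem :: "nat \<Rightarrow> nat \<Rightarrow> (nat \<Rightarrow> nat set) \<Rightarrow> ereal mat \<Rightarrow> bool" where
  "ppicod_problem m n H P \<longleftrightarrow>
     m \<ge> 1 \<and> n \<ge> 1 \<and>
     (\<forall>i<n. H i \<subset> {..<m}) \<and>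
     P \<in> carrier_mat n m \<and>
     (\<forall>i<n. \<forall>j<m. if j \<in> H i then P $$ (i, j) = \<infinity> else \<bar>P $$ (i, j)\<bar> \<noteq> \<infinity>)"

definition decoding_choices :: "nat \<Rightarrow> nat \<Rightarrow> (nat \<Rightarrow> nat set) \<Rightarrow> (nat \<Rightarrow> nat) set" where
  "decoding_choices m n H = (\<Pi>\<^sub>E i\<in>{..<n}. {..<m} - H i)"

text \<open>The subfamily of the messages indexed by \<open>S\<close>, as an extensional function on \<open>S\<close>.\<close>

definition side_info :: "nat set \<Rightarrow> 'q vec \<Rightarrow> nat \<Rightarrow> 'q" where
  "side_info S X = (\<lambda>j\<in>S. X $ j)"

text \<open>A linear code of length \<open>l\<close> is given by the encoding matrix \<open>A\<close>, the decoding choice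
  \<open>D\<close>, and the decoding functions \<open>G i\<close>.\<close>

definition linear_code ::
  "nat \<Rightarrow> nat \<Rightarrow> (nat \<Rightarrow> nat set) \<Rightarrow> nat \<Rightarrow> 'q::{field,finite} mat \<Rightarrow> (nat \<Rightarrow> nat)
    \<Rightarrow> (nat \<Rightarrow> 'q vec \<Rightarrow> (nat \<Rightarrow> 'q) \<Rightarrow> 'q) \<Rightarrow> bool" where
  "linear_code m n H l A D G \<longleftrightarrow>
     A \<in> carrier_mat l m \<and>
     D \<in> decoding_choices m n H \<and>
     (\<forall>i<n. \<forall>X\<in>carrier_vec m. G i (A *\<^sub>v X) (side_info (H i) X) = X $ D i)"

definition satisfaction :: "nat \<Rightarrow> ereal mat \<Rightarrow> (nat \<Rightarrow> nat) \<Rightarrow> ereal" where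
  "satisfaction n P D = (\<Sum>i<n. P $$ (i, D i))"

definition feasible_region ::
  "'q::{field,finite} itself \<Rightarrow> nat \<Rightarrow> nat \<Rightarrow> (nat \<Rightarrow> nat set) \<Rightarrow> ereal mat \<Rightarrow> (nat \<times> ereal) set" where
  "feasible_region _ m n H P =
     {(l, satisfaction n P D) | l (A :: 'q mat) D G. linear_code m n H l A D G}"

text \<open>For a decoding choice \<open>D\<close> the minimum exists: the identity matrix gives a code of
  length \<open>m\<close>.\<close>

definition min_length ::
  "'q::{field,finite} itself \<Rightarrow> nat \<Rightarrow> nat \<Rightarrow> (nat \<Rightarrow> nat set) \<Rightarrow> (nat \<Rightarrow> nat) \<Rightarrow> nat" where
  "min_length _ m n H D = (LEAST l. \<exists>(A :: 'q mat) G. linear_code m n H l A D G)"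

definition decoding_centric_region ::
  "'q::{field,finite} itself \<Rightarrow> nat \<Rightarrow> nat \<Rightarrow> (nat \<Rightarrow> nat set) \<Rightarrow> ereal mat \<Rightarrow> (nat \<times> ereal) set" where
  "decoding_centric_region q m n H P =
     {(min_length q m n H D, satisfaction n P D) | D. D \<in> decoding_choices m n H}"

definition dominates :: "nat \<times> ereal \<Rightarrow> nat \<times> ereal \<Rightarrow> bool" where
  "dominates p r \<longleftrightarrow>
     fst p \<le> fst r \<and> snd p \<le> snd r \<and> (fst p < fst r \<or> snd p < snd r)"

definition pareto_boundary :: "(nat \<times> ereal) set \<Rightarrow> (nat \<times> ereal) set" where
  "pareto_boundary T = {r \<in> T. \<not> (\<exists>p\<in>T. dominates p r)}"

end

theory Submission imports Defs begin

text \<open>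
  Shortening a code without changing its decoding choice keeps the satisfaction metric, so every
  feasible point lies weakly above a point of the decoding-centric region. Since the latter region
  is contained in the feasible one, the two have the same nondominated points.
\<close>

lemma dominates_weaken:
  assumes "dominates p r" "fst p' \<le> fst p" "snd p' \<le> snd p"
  shows "dominates p' r"
  using assms unfolding dominates_def by (meson order.trans order.strict_trans1)

text \<open>A point of \<open>T\<close> that dominates \<open>r\<close> can be replaced by a point
  of \<open>S\<close> below it, which still dominates \<open>r\<close>. Conversely, the only point
  of \<open>S\<close> below a nondominated point of \<open>T\<close> is that point itself.\<close>

lemma pareto_boundary_eqI:
  assumes sub: "S \<subseteq> T"
    and below: "\<And>r. r \<in> T \<Longrightarrow> \<exists>p\<in>S. fst p \<le> fst r \<and> snd p \<le> snd r"
  shows "pareto_boundary S = pareto_boundary T"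
proof (intro equalityI subsetI)
  fix r assume r: "r \<in> pareto_boundary S"
  have "\<not> dominates p r" if "p \<in> T" for p
    using below[OF that] dominates_weaken r unfolding pareto_boundary_def by blast
  with r sub show "r \<in> pareto_boundary T"
    unfolding pareto_boundary_def by blast
next
  fix r assume r: "r \<in> pareto_boundary T"
  then obtain p where p: "p \<in> S" "fst p \<le> fst r" "snd p \<le> snd r"
    using below unfolding pareto_boundary_def by blast
  with r sub have "\<not> dominates p r"
    unfolding pareto_boundary_def by blast
  \<comment> \<open>Without domination neither inequality is strict, so both coordinates
    agree.\<close>
  with p have "p = r"
    by (auto simp: dominates_def prod_eq_iff)
  with p r sub show "r \<in> pareto_boundary S"
    unfolding pareto_boundary_def by blast
qed

text \<open>All messages are sent uncoded and side information is ignored. This makes the set of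
  lengths in \<open>min_length\<close> nonempty, so its \<open>LEAST\<close> is a genuine
  minimum.\<close>

lemma linear_code_identity:
  assumes "D \<in> decoding_choices m n H"
  shows "linear_code m n H m (1\<^sub>m m :: 'q::{field,finite} mat) D (\<lambda>i y _. y $ D i)"
  using assms by (auto simp: linear_code_def)

lemma min_length_attained:
  assumes "D \<in> decoding_choices m n H"
  shows "\<exists>(A :: 'q::{field,finite} mat) G.
    linear_code m n H (min_length TYPE('q) m n H D) A D G"
  unfolding min_length_def by (rule LeastI_ex) (use linear_code_identity[OF assms] in blast)

lemma min_length_le:
  fixes A :: "'q::{field,finite} mat"
  assumes "linear_code m n H l A D G"
  shows "min_length TYPE('q) m n H D \<le> l"
  unfolding min_length_def by (rule Least_le) (use assms in blast)

theorem proposition5: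
  fixes m n :: nat and H :: "nat \<Rightarrow> nat set" and P :: "ereal mat"
  assumes "ppicod_problem m n H P"
  shows "pareto_boundary (decoding_centric_region TYPE('q::{field,finite}) m n H P)
       = pareto_boundary (feasible_region TYPE('q) m n H P)"
proof (rule pareto_boundary_eqI)
  show "decoding_centric_region TYPE('q) m n H P \<subseteq> feasible_region TYPE('q) m n H P"
    unfolding decoding_centric_region_def feasible_region_def
    using min_length_attained[where 'q = 'q] by blast
next
  fix r assume "r \<in> feasible_region TYPE('q) m n H P"
  then obtain l D G and A :: "'q mat"
    where r: "r = (l, satisfaction n P D)" and code: "linear_code m n H l A D G"
    unfolding feasible_region_def by blast
  have "D \<in> decoding_choices m n H"
    using code by (simp add: linear_code_def)
  then have "(min_length TYPE('q) m n H D, satisfaction n P D)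
      \<in> decoding_centric_region TYPE('q) m n H P"
    unfolding decoding_centric_region_def by blast
  \<comment> \<open>Both points use the same \<open>D\<close>, so their second coordinates are equal
    and only the lengths need comparing.\<close>
  then show "\<exists>p\<in>decoding_centric_region TYPE('q) m n H P. fst p \<le> fst r \<and> snd p \<le> snd r"
    using min_length_le[OF code] by (intro bexI) (simp_all add: r)
qed

end
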